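(* Let $m,n\geq 3$. For $0\le x,y\le m-1$ and $0\le x',y'\le n-1$, the normalized Green's function $\mathbf{G}$ of the torus $C_m\times C_n$ satisfies, writing $c_k=\cos(2\pi k/n)$, $$\begin{aligned}\mathbf{G}((x,x'),(y,y'))=\;&\frac{2}{n}\sum_{k=1}^{n-1}\exp\big((2\pi ik/n)(y'-x')\big)\left[-\frac{1}{m(1-c_k)}+\frac{T_{m/2-|y-x|}(2-c_k)}{(1-c_k)(3-c_k)\,U_{m/2-1}(2-c_k)}\right]\\&+\frac{2}{n}\left(\frac{(m+1)(m-1)}{6m}-|y-x|+\frac{(y-x)^2}{m}\right)+\frac{2}{m}\left(\frac{(n+1)(n-1)}{6n}-|y'-x'|+\frac{(y'-x')^2}{n}\right).\end{aligned}$$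
   Context: $C_m$ is the cycle on $\{0,\ldots,m-1\}$ with $x\sim y$ iff $y\equiv x\pm1\pmod m$. The torus $C_m\times C_n$ is the Cartesian product: vertex set $\{0,\ldots,m-1\}\times\{0,\ldots,n-1\}$, with $(x,x')\sim(y,y')$ iff ($x=y$ and $x'\sim y'$ in $C_n$) or ($x'=y'$ and $x\sim y$ in $C_m$); it is $4$-regular. Its normalized Laplacian $\mathcal{L}$ has $\mathcal{L}(v,v)=1$, $\mathcal{L}(v,w)=-1/4$ if $v\sim w$, $0$ otherwise, and its normalized Green's function is $\mathbf{G}(v,w)=\sum_{j:\lambda_j>0}\frac1{\lambda_j}\phi_j(v)\overline{\phi_j(w)}$ for any orthonormal eigensystem $\{(\lambda_j,\phi_j)\}$ of $\mathcal{L}$. For real $z>1$ and $\nu\in\frac12\mathbb{Z}$, $T_\nu(z):=\cosh(\nu\,\mathrm{arccosh}\,z)$ and $U_\nu(z):=\sinh((\nu+1)\,\mathrm{arccosh}\,z)/\sinh(\mathrm{arccosh}\,z)$; for integers $\nu\ge0$ these are the Chebyshev polynomials of the first and second kind, $T_\nu(\cos\theta)=\cos\nu\theta$, $U_\nu(\cos\theta)=\sin((\nu+1)\theta)/\sin\theta$. *)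

theory Defs
  imports Complex_Main "HOL-Number_Theory.Cong"
begin

definition cycle_adj :: "nat \<Rightarrow> nat \<Rightarrow> nat \<Rightarrow> bool" where
  "cycle_adj m x y \<longleftrightarrow> x < m \<and> y < m \<and>
     ([int y = int x + 1] (mod int m) \<or> [int y = int x - 1] (mod int m))"

definition torus_verts :: "nat \<Rightarrow> nat \<Rightarrow> (nat \<times> nat) set" where
  "torus_verts m n = {..<m} \<times> {..<n}"

definition torus_adj :: "nat \<Rightarrow> nat \<Rightarrow> nat \<times> nat \<Rightarrow> nat \<times> nat \<Rightarrow> bool" where
  "torus_adj m n v w \<longleftrightarrow> v \<in> torus_verts m n \<and> w \<in> torus_verts m n \<and>
     (fst v = fst w \<and> cycle_adj n (snd v) (snd w) \<or>
      snd v = snd w \<and> cycle_adj m (fst v) (fst w))"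

text \<open>The torus is 4-regular only for \<open>m, n \<ge> 3\<close>; the normalized Laplacian below is
  meant for that range.\<close>

definition torus_laplacian :: "nat \<Rightarrow> nat \<Rightarrow> nat \<times> nat \<Rightarrow> nat \<times> nat \<Rightarrow> real" where
  "torus_laplacian m n v w =
     (if v = w then 1 else if torus_adj m n v w then - 1 / 4 else 0)"

text \<open>Eigenpairs are indexed by \<open>j < card V\<close>, so an orthonormal family of eigenvectors is
  automatically a basis of the space of complex functions on \<open>V\<close>.\<close>

definition orthonormal_eigensystem ::
    "'v set \<Rightarrow> ('v \<Rightarrow> 'v \<Rightarrow> real) \<Rightarrow> (nat \<Rightarrow> real) \<Rightarrow> (nat \<Rightarrow> 'v \<Rightarrow> complex) \<Rightarrow> bool" where
  "orthonormal_eigensystem V L lam phi \<longleftrightarrow>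
     (\<forall>j<card V. \<forall>v\<in>V. (\<Sum>w\<in>V. complex_of_real (L v w) * phi j w) = complex_of_real (lam j) * phi j v) \<and>
     (\<forall>j<card V. \<forall>k<card V. (\<Sum>v\<in>V. phi j v * cnj (phi k v)) = (if j = k then 1 else 0))"

text \<open>The spectral sum does not depend on the choice of the eigensystem; the definite
  description selects the common value over all eigensystems.\<close>

definition greens_function :: "'v set \<Rightarrow> ('v \<Rightarrow> 'v \<Rightarrow> real) \<Rightarrow> 'v \<Rightarrow> 'v \<Rightarrow> complex" where
  "greens_function V L v w = (THE g. \<forall>lam phi. orthonormal_eigensystem V L lam phi \<longrightarrow>
     g = (\<Sum>j | j < card V \<and> lam j > 0. complex_of_real (1 / lam j) * phi j v * cnj (phi j w)))"

definition torus_green :: "nat \<Rightarrow> nat \<Rightarrow> nat \<times> nat \<Rightarrow> nat \<times> nat \<Rightarrow> complex" where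
  "torus_green m n = greens_function (torus_verts m n) (torus_laplacian m n)"

text \<open>Chebyshev functions with real (in particular half-integer) index, for arguments \<open>z > 1\<close>.\<close>

definition cheb_T :: "real \<Rightarrow> real \<Rightarrow> real" where
  "cheb_T \<nu> z = cosh (\<nu> * arcosh z)"

definition cheb_U :: "real \<Rightarrow> real \<Rightarrow> real" where
  "cheb_U \<nu> z = sinh ((\<nu> + 1) * arcosh z) / sinh (arcosh z)"

end

theory Submission
  imports Defs "Jordan_Normal_Form.Determinant" "HOL-Library.Real_Mod"
begin

text \<open>For a symmetric \<open>L\<close>, eigenvectors from two orthonormal eigensystems overlap only when their
  eigenvalues agree, so the spectral sum may be computed in the basis of characters. There the
  eigenvalues are \<open>(2 - cos \<theta>\<^sub>a - c\<^sub>b) / 2\<close>. For \<open>b \<noteq> 0\<close> put \<open>cosh t = 2 - c\<^sub>b\<close>: the sum over \<open>a\<close>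
  inverts the discrete Fourier transform of \<open>d \<mapsto> cosh ((m/2 - d) t) / (sinh t sinh (m t/2))\<close>, which
  is the fundamental solution of a second-order difference equation on the cycle. For \<open>b = 0\<close> the
  fundamental solution modulo constants is quadratic in \<open>d\<close>. The remaining terms
  \<open>- 1 / (m (1 - c\<^sub>b))\<close> of the formula cancel its last summand, by the quadratic case for \<open>C\<^sub>n\<close>.\<close>

section \<open>Orthonormal eigensystems and independence of the spectral sum from their
  choice\<close>

text \<open>With as many functions as points, orthonormality says that a square matrix times its
  conjugate transpose is the identity. A one-sided inverse of a square matrix is two-sided, and the
  product in the other order is the completeness relation.\<close>

lemma orthonormal_eigensystem_complete:
  assumes "finite V" and sys: "orthonormal_eigensystem V L lam phi" and "v \<in> V" and "w \<in> V"
  shows "(\<Sum>j<card V. phi j v * cnj (phi j w)) = (if v = w then 1 else 0)"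
proof -
  define N where "N = card V"
  obtain h where h: "bij_betw h {0..<N} V"
    using ex_bij_betw_nat_finite[OF \<open>finite V\<close>] by (auto simp: N_def)
  define A where "A = mat N N (\<lambda>(j, i). phi j (h i))"
  define B where "B = mat N N (\<lambda>(i, j). cnj (phi j (h i)))"
  have carr: "A \<in> carrier_mat N N" "B \<in> carrier_mat N N"
    by (auto simp: A_def B_def)
  have "A * B = 1\<^sub>m N"
  proof (rule eq_matI)
    fix j k assume "j < dim_row (1\<^sub>m N :: complex mat)" "k < dim_col (1\<^sub>m N :: complex mat)"
    then have jk: "j < N" "k < N" by auto
    have "(A * B) $$ (j, k) = (\<Sum>i\<in>{0..<N}. phi j (h i) * cnj (phi k (h i)))"
      using jk by (simp add: A_def B_def scalar_prod_def)
    also have "\<dots> = (\<Sum>v\<in>V. phi j v * cnj (phi k v))"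
      by (rule sum.reindex_bij_betw[OF h])
    also have "\<dots> = (if j = k then 1 else 0)"
      using sys jk by (auto simp: orthonormal_eigensystem_def N_def)
    finally show "(A * B) $$ (j, k) = 1\<^sub>m N $$ (j, k)" using jk by simp
  qed (use carr in auto)
  then have BA: "B * A = 1\<^sub>m N"
    using mat_mult_left_right_inverse carr by blast
  obtain p q where pq: "p < N" "q < N" "h p = v" "h q = w"
    using h \<open>v \<in> V\<close> \<open>w \<in> V\<close> unfolding bij_betw_def by fastforce
  have "(B * A) $$ (q, p) = (\<Sum>j\<in>{0..<N}. cnj (phi j w) * phi j v)"
    using pq by (simp add: A_def B_def scalar_prod_def)
  moreover have "q = p \<longleftrightarrow> v = w"
    using pq h by (auto simp: bij_betw_def inj_on_def)
  ultimately show ?thesis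
    using pq by (simp add: BA N_def atLeast0LessThan mult.commute eq_commute)
qed

text \<open>Moving the real symmetric \<open>L\<close> from one factor of the inner product to the
  other gives \<open>lam j * S = mu k * S\<close> for the overlap \<open>S\<close>.\<close>

lemma eigensystem_overlap:
  assumes "finite V" and sym: "\<And>v w. v \<in> V \<Longrightarrow> w \<in> V \<Longrightarrow> L v w = L w v"
    and sys: "orthonormal_eigensystem V L lam phi" "orthonormal_eigensystem V L mu psi"
    and "j < card V" "k < card V" "lam j \<noteq> mu k"
  shows "(\<Sum>u\<in>V. cnj (phi j u) * psi k u) = 0"
proof -
  let ?S = "\<Sum>u\<in>V. cnj (phi j u) * psi k u"
  have phi: "(\<Sum>w\<in>V. L v w * phi j w) = lam j * phi j v" if "v \<in> V" for v
    using sys(1) that \<open>j < card V\<close> by (auto simp: orthonormal_eigensystem_def)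
  have psi: "(\<Sum>w\<in>V. L v w * psi k w) = mu k * psi k v" if "v \<in> V" for v
    using sys(2) that \<open>k < card V\<close> by (auto simp: orthonormal_eigensystem_def)
  have "lam j * ?S = (\<Sum>v\<in>V. cnj (lam j * phi j v) * psi k v)"
    by (simp add: sum_distrib_left mult.assoc)
  also have "\<dots> = (\<Sum>v\<in>V. \<Sum>w\<in>V. L v w * cnj (phi j w) * psi k v)"
    by (intro sum.cong refl, subst phi[symmetric]) (auto simp: sum_distrib_right)
  also have "\<dots> = (\<Sum>w\<in>V. \<Sum>v\<in>V. L v w * cnj (phi j w) * psi k v)"
    by (rule sum.swap)
  also have "\<dots> = (\<Sum>w\<in>V. cnj (phi j w) * (\<Sum>v\<in>V. L w v * psi k v))"
    by (simp add: sum_distrib_left sym mult_ac)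
  also have "\<dots> = (\<Sum>w\<in>V. cnj (phi j w) * (mu k * psi k w))"
    by (intro sum.cong refl) (simp add: psi)
  also have "\<dots> = mu k * ?S"
    by (simp add: sum_distrib_left mult_ac)
  finally show ?thesis
    using \<open>lam j \<noteq> mu k\<close> by simp
qed

text \<open>Both sides are the kernel of the operator \<open>f(L)\<close>. The overlap matrix
  \<open>S\<close> translates one basis into the other, and \<open>f (lam j)\<close> may be traded
  for \<open>f (mu k)\<close> wherever \<open>S j k\<close> is nonzero.\<close>

lemma spectral_sum_unique:
  fixes f :: "real \<Rightarrow> complex"
  assumes "finite V" and sym: "\<And>v w. v \<in> V \<Longrightarrow> w \<in> V \<Longrightarrow> L v w = L w v"
    and sys: "orthonormal_eigensystem V L lam phi" "orthonormal_eigensystem V L mu psi"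
    and vw: "v \<in> V" "w \<in> V"
  shows "(\<Sum>j<card V. f (lam j) * phi j v * cnj (phi j w)) =
         (\<Sum>j<card V. f (mu j) * psi j v * cnj (psi j w))"
proof -
  let ?N = "card V"
  define S where "S j k = (\<Sum>u\<in>V. cnj (phi j u) * psi k u)" for j k
  have expand_phi: "cnj (phi j w) = (\<Sum>k<?N. S j k * cnj (psi k w))" for j
  proof -
    have "(\<Sum>k<?N. S j k * cnj (psi k w)) =
          (\<Sum>u\<in>V. cnj (phi j u) * (\<Sum>k<?N. psi k u * cnj (psi k w)))"
      unfolding S_def sum_distrib_left sum_distrib_right
      by (subst sum.swap) (simp add: mult.assoc)
    also have "\<dots> = (\<Sum>u\<in>V. cnj (phi j u) * (if u = w then 1 else 0))"
      using orthonormal_eigensystem_complete[OF \<open>finite V\<close> sys(2)] vw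
      by (intro sum.cong refl) simp
    also have "\<dots> = cnj (phi j w)"
      using \<open>finite V\<close> vw by (simp add: if_distrib cong: if_cong)
    finally show ?thesis by simp
  qed
  have expand_psi: "psi k v = (\<Sum>j<?N. S j k * phi j v)" for k
  proof -
    have "(\<Sum>j<?N. S j k * phi j v) =
          (\<Sum>u\<in>V. psi k u * (\<Sum>j<?N. phi j v * cnj (phi j u)))"
      unfolding S_def sum_distrib_left sum_distrib_right
      by (subst sum.swap) (simp add: mult_ac)
    also have "\<dots> = (\<Sum>u\<in>V. psi k u * (if v = u then 1 else 0))"
      using orthonormal_eigensystem_complete[OF \<open>finite V\<close> sys(1)] vw
      by (intro sum.cong refl) simp
    also have "\<dots> = psi k v"
      using \<open>finite V\<close> vw by (simp add: if_distrib cong: if_cong)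
    finally show ?thesis by simp
  qed
  have swap: "f (lam j) * S j k = f (mu k) * S j k" if "j < ?N" "k < ?N" for j k
    using eigensystem_overlap[OF \<open>finite V\<close> sym sys that] by (cases "lam j = mu k") (auto simp: S_def)
  have "(\<Sum>j<?N. f (lam j) * phi j v * cnj (phi j w)) =
        (\<Sum>j<?N. \<Sum>k<?N. (f (lam j) * S j k) * phi j v * cnj (psi k w))"
    by (simp add: expand_phi sum_distrib_left mult_ac)
  also have "\<dots> = (\<Sum>j<?N. \<Sum>k<?N. (f (mu k) * S j k) * phi j v * cnj (psi k w))"
    by (intro sum.cong refl) (simp add: swap)
  also have "\<dots> = (\<Sum>k<?N. \<Sum>j<?N. (f (mu k) * S j k) * phi j v * cnj (psi k w))"
    by (rule sum.swap)
  also have "\<dots> = (\<Sum>k<?N. f (mu k) * psi k v * cnj (psi k w))"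
    by (simp add: expand_psi sum_distrib_left sum_distrib_right mult_ac)
  finally show ?thesis .
qed

text \<open>Replaces the definite description by a sum over one convenient eigensystem. The
  restriction to positive eigenvalues becomes a weight that is 0 elsewhere, so that
  \<open>spectral_sum_unique\<close> applies; the given eigensystem forces uniqueness of the
  described value.\<close>

lemma greens_function_eq_spectral_sum:
  assumes "finite V" and "\<And>v w. v \<in> V \<Longrightarrow> w \<in> V \<Longrightarrow> L v w = L w v"
    and sys: "orthonormal_eigensystem V L lam phi" and "v \<in> V" "w \<in> V"
  shows "greens_function V L v w =
    (\<Sum>j<card V. (if lam j > 0 then complex_of_real (1 / lam j) else 0) * phi j v * cnj (phi j w))"
proof -
  let ?f = "\<lambda>l. if l > 0 then complex_of_real (1 / l) else 0"
  have restrict: "(\<Sum>j | j < card V \<and> mu j > 0. complex_of_real (1 / mu j) * psi j v * cnj (psi j w)) =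
    (\<Sum>j<card V. ?f (mu j) * psi j v * cnj (psi j w))" for mu psi
    by (rule sum.mono_neutral_cong_left) auto
  show ?thesis
    unfolding greens_function_def restrict
  proof (rule the_equality)
    show "\<forall>mu psi. orthonormal_eigensystem V L mu psi \<longrightarrow>
      (\<Sum>j<card V. ?f (lam j) * phi j v * cnj (phi j w)) =
      (\<Sum>j<card V. ?f (mu j) * psi j v * cnj (psi j w))"
      by (intro allI impI spectral_sum_unique[where L = L]) (use assms in auto)
  qed (use sys in blast)
qed

section \<open>Characters of the cyclic group\<close>

text \<open>The character of frequency \<open>a\<close> on the integers modulo \<open>m\<close>. The
  position is an integer so that differences of vertices can be inserted without truncation.\<close>

definition cycle_char :: "nat \<Rightarrow> nat \<Rightarrow> int \<Rightarrow> complex" where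
  "cycle_char m a d = cis (2 * pi * real a * real_of_int d / real m)"

lemma cycle_char_0 [simp]: "cycle_char m a 0 = 1" "cycle_char m 0 d = 1"
  by (simp_all add: cycle_char_def)

lemma cycle_char_add: "cycle_char m a (d + e) = cycle_char m a d * cycle_char m a e"
  by (simp add: cycle_char_def cis_mult algebra_simps add_divide_distrib)

lemma cnj_cycle_char: "cnj (cycle_char m a d) = cycle_char m a (- d)"
  by (simp add: cycle_char_def cis_cnj)

lemma cycle_char_multiple:
  assumes "int m dvd d"
  shows "cycle_char m a d = 1"
proof (cases "m = 0")
  case False
  obtain e where "d = int m * e" using assms by blast
  then have "cycle_char m a d = cis (of_int (int a * e) * (2 * pi))"
    using False by (simp add: cycle_char_def field_simps)
  then show ?thesis by (simp only: cis_eq_1_iff) blast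
\<comment> \<open>For \<open>m = 0\<close> the quotient in the definition is 0 by the convention on
  division, and \<open>cis 0 = 1\<close>.\<close>
qed (simp add: cycle_char_def)

lemma cycle_char_cong:
  assumes "[d = e] (mod int m)"
  shows "cycle_char m a d = cycle_char m a e"
  using cycle_char_add[of m a e "d - e"] assms
  by (simp add: cycle_char_multiple cong_iff_dvd_diff)

lemma cycle_char_power: "cycle_char m 1 d ^ a = cycle_char m a d"
  by (simp add: cycle_char_def Complex.DeMoivre mult_ac)

lemma cycle_char_1_eq_1_iff:
  assumes "m > 0"
  shows "cycle_char m 1 d = 1 \<longleftrightarrow> int m dvd d"
proof
  assume "cycle_char m 1 d = 1"
  then obtain e :: int where "2 * pi * real_of_int d / real m = of_int e * (2 * pi)"
    by (auto simp: cycle_char_def cis_eq_1_iff)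
  then have "real_of_int d = of_int (int m * e)"
    using assms by (simp add: field_simps)
  then have "d = int m * e" by (simp only: of_int_eq_iff)
  then show "int m dvd d" by simp
qed (rule cycle_char_multiple)

text \<open>A geometric series whose ratio \<open>cycle_char m 1 d\<close> is an \<open>m\<close>-th
  root of unity; the ratio is 1 only if \<open>m\<close> divides \<open>d\<close>.\<close>

lemma sum_cycle_char:
  assumes "m > 0"
  shows "(\<Sum>a<m. cycle_char m a d) = (if int m dvd d then of_nat m else 0)"
proof (cases "int m dvd d")
  case False
  have "(1 - cycle_char m 1 d) * (\<Sum>a<m. cycle_char m 1 d ^ a) = 1 - cycle_char m 1 d ^ m"
    by (rule one_diff_power_eq[symmetric])
  also have "\<dots> = 0"
    using assms by (simp add: cycle_char_def Complex.DeMoivre)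
  finally show ?thesis
    using False cycle_char_1_eq_1_iff[OF assms, of d] unfolding cycle_char_power by simp
qed (simp add: cycle_char_multiple)

lemma cycle_char_plus_inverse:
  "cycle_char m a 1 + cycle_char m a (- 1) = 2 * complex_of_real (cos (2 * pi * real a / real m))"
  by (simp add: cycle_char_def complex_eq_iff)

lemma int_dvd_diff_iff_eq:
  assumes "a < m" "b < m"
  shows "int m dvd int b - int a \<longleftrightarrow> a = b"
  using assms zdvd_imp_le[of "int m" "int b - int a"] zdvd_imp_le[of "int m" "int a - int b"]
  by (cases a b rule: linorder_cases) (auto simp: dvd_diff_commute)

lemma sum_cycle_char_orthogonal:
  assumes "a < m" "b < m"
  shows "(\<Sum>d<m. cycle_char m a (- int d) * cnj (cycle_char m b (- int d))) =
         (if a = b then of_nat m else 0)"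
proof -
  \<comment> \<open>Frequency and position enter a character symmetrically, so the sum over
    positions can be read as a sum over frequencies.\<close>
  have "cycle_char m a (- int d) * cnj (cycle_char m b (- int d)) = cycle_char m d (int b - int a)" for d
    by (simp add: cycle_char_def cis_cnj cis_mult algebra_simps diff_divide_distrib)
  then show ?thesis
    using assms by (simp add: sum_cycle_char int_dvd_diff_iff_eq)
qed

section \<open>Fourier inversion and fundamental solutions on the cycle\<close>

lemma cycle_fourier_inversion:
  fixes H :: "nat \<Rightarrow> complex"
  assumes "d < m"
  shows "(\<Sum>a<m. (\<Sum>e<m. H e * cycle_char m a (- int e)) * cycle_char m a (int d)) = of_nat m * H d"
proof -
  have "(\<Sum>a<m. (\<Sum>e<m. H e * cycle_char m a (- int e)) * cycle_char m a (int d)) =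
    (\<Sum>e<m. H e * (\<Sum>a<m. cycle_char m a (- int e) * cycle_char m a (int d)))"
    unfolding sum_distrib_left sum_distrib_right by (subst sum.swap) (simp add: mult.assoc)
  also have "\<dots> = (\<Sum>e<m. H e * (if e = d then of_nat m else 0))"
  proof (intro sum.cong refl)
    fix e assume "e \<in> {..<m}"
    then show "H e * (\<Sum>a<m. cycle_char m a (- int e) * cycle_char m a (int d)) =
        H e * (if e = d then of_nat m else 0)"
      using \<open>d < m\<close>
      by (simp add: cycle_char_add[symmetric] sum_cycle_char int_dvd_diff_iff_eq)
  qed
  also have "\<dots> = of_nat m * H d"
    using assms by (simp add: if_distrib cong: if_cong)
  finally show ?thesis .
qed

text \<open>The constant \<open>\<kappa>\<close> accounts for the projection onto constants, needed when \<open>z = 1\<close>.\<close>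

lemma cycle_resolvent_fourier:
  fixes H :: "nat \<Rightarrow> complex" and z \<kappa> :: complex
  assumes "m > 0" and periodic: "H m = H 0"
    and interior: "\<And>d. 0 < d \<Longrightarrow> d < m \<Longrightarrow> z * H d - (H (d - 1) + H (Suc d)) / 2 = - \<kappa>"
    and boundary: "z * H 0 - (H (m - 1) + H 1) / 2 = 1 - \<kappa>"
  shows "(z - complex_of_real (cos (2 * pi * real a / real m))) *
           (\<Sum>d<m. H d * cycle_char m a (- int d)) =
         1 - \<kappa> * (\<Sum>d<m. cycle_char m a (- int d))"
proof -
  obtain M where M: "m = Suc M" using \<open>m > 0\<close> gr0_implies_Suc by blast
  define u where "u d = cycle_char m a (- int d)" for d
  \<comment> \<open>\<open>P\<close> is \<open>H\<close> shifted cyclically by one place, with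
    \<open>M = m - 1\<close> as the predecessor of 0.\<close>
  define P where "P d = (if d = 0 then H M else H (d - 1))" for d
  let ?S = "\<Sum>d<m. H d * u d"
  have u0: "u 0 = 1" and um: "u (Suc M) = 1"
    using cycle_char_multiple[of m "- int m" a] by (simp_all add: u_def flip: M)
  have u_Suc: "u (Suc d) = u d * cycle_char m a (- 1)" for d
    using cycle_char_add[of m a "- int d" "- 1"] by (simp add: u_def algebra_simps)
  have u_pred: "u d = u (Suc d) * cycle_char m a 1" for d
    using cycle_char_add[of m a "- int (Suc d)" 1] by (simp add: u_def algebra_simps)
  \<comment> \<open>A shift of the index turns a translation of \<open>H\<close> into a factor from
    the character; the wrap-around term fits because \<open>u\<close> is 1 at both 0 and
    \<open>m\<close>.\<close>
  have "(\<Sum>d<m. P d * u d) = (\<Sum>d<m. H d * u (Suc d))"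
    unfolding M by (subst sum.lessThan_Suc_shift) (simp add: P_def u0 um)
  then have left: "(\<Sum>d<m. P d * u d) = cycle_char m a (- 1) * ?S"
    by (simp add: u_Suc sum_distrib_left mult_ac)
  have "(\<Sum>d<m. H (Suc d) * u d) = cycle_char m a 1 * (\<Sum>d<m. H (Suc d) * u (Suc d))"
    by (subst u_pred) (simp add: sum_distrib_left mult_ac)
  \<comment> \<open>The term with index \<open>m\<close> takes the place of the term with index 0
    because \<open>H m = H 0\<close>.\<close>
  also have "(\<Sum>d<m. H (Suc d) * u (Suc d)) = ?S"
    unfolding M by (subst (2) sum.lessThan_Suc_shift) (use periodic M u0 um in simp)
  finally have right: "(\<Sum>d<m. H (Suc d) * u d) = cycle_char m a 1 * ?S" .
  have "(z - complex_of_real (cos (2 * pi * real a / real m))) * ?S =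
        z * ?S - (cycle_char m a 1 + cycle_char m a (- 1)) / 2 * ?S"
    unfolding cycle_char_plus_inverse by (simp add: algebra_simps)
  also have "\<dots> = z * ?S - ((\<Sum>d<m. P d * u d) + (\<Sum>d<m. H (Suc d) * u d)) / 2"
    unfolding left right by (simp add: field_simps)
  also have "\<dots> = (\<Sum>d<m. (z * H d - (P d + H (Suc d)) / 2) * u d)"
    by (simp add: sum_distrib_left sum_subtractf sum.distrib sum_divide_distrib algebra_simps add_divide_distrib)
  \<comment> \<open>The difference equations say that the operator maps \<open>H\<close> to the unit
    mass at 0 minus the constant \<open>\<kappa>\<close>.\<close>
  also have "\<dots> = (\<Sum>d<m. ((if d = 0 then 1 else 0) - \<kappa>) * u d)"
  proof (intro sum.cong refl)
    fix d assume "d \<in> {..<m}"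
    then show "(z * H d - (P d + H (Suc d)) / 2) * u d = ((if d = 0 then 1 else 0) - \<kappa>) * u d"
      using interior[of d] boundary M by (auto simp: P_def)
  qed
  also have "\<dots> = 1 - \<kappa> * (\<Sum>d<m. u d)"
    using \<open>m > 0\<close> u0
    by (simp add: left_diff_distrib sum_subtractf sum_distrib_left if_distrib[of "\<lambda>x. x * _"] cong: if_cong)
  finally show ?thesis by (simp add: u_def)
qed

text \<open>The function \<open>h\<close> solves the difference equation with
  \<open>z = cosh t\<close> and \<open>\<kappa> = 0\<close>, so its Fourier coefficients are the
  reciprocals of \<open>cosh t - cos\<close>; inversion recovers \<open>h\<close>.\<close>

lemma sum_cycle_char_over_cosh_minus_cos_nat:
  fixes t :: real
  assumes "t > 0" "d < m"
  shows "(\<Sum>a<m. cycle_char m a (int d) / complex_of_real (cosh t - cos (2 * pi * real a / real m))) =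
    complex_of_real (real m * cosh ((real m / 2 - real d) * t) / (sinh t * sinh (real m / 2 * t)))"
proof -
  define h where "h e = cosh ((real m / 2 - real e) * t) / (sinh t * sinh (real m / 2 * t))" for e :: nat
  have "m > 0" using assms by simp
  have nz: "sinh t \<noteq> 0" "sinh (real m / 2 * t) \<noteq> 0"
    using \<open>m > 0\<close> \<open>t > 0\<close> by simp_all
  have fourier: "complex_of_real (cosh t - cos (2 * pi * real a / real m)) *
      (\<Sum>e<m. complex_of_real (h e) * cycle_char m a (- int e)) = 1" for a
  proof -
    \<comment> \<open>Since \<open>cosh\<close> is even, centring at \<open>m / 2\<close> makes
      \<open>h\<close> invariant under the reflection of \<open>e\<close> to \<open>m - e\<close>;
      this yields both boundary identities.\<close>
    have h_m: "h m = h 0"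
    proof -
      have "cosh ((real m / 2 - real m) * t) = cosh (- ((real m / 2 - real m) * t))"
        by (rule cosh_minus[symmetric])
      also have "- ((real m / 2 - real m) * t) = (real m / 2 - real 0) * t"
        by (simp add: algebra_simps)
      finally show ?thesis by (simp add: h_def)
    qed
    have h_pred: "h (m - 1) = h 1"
    proof -
      have "cosh ((real m / 2 - real (m - 1)) * t) = cosh (- ((real m / 2 - real (m - 1)) * t))"
        by (rule cosh_minus[symmetric])
      also have "- ((real m / 2 - real (m - 1)) * t) = (real m / 2 - real 1) * t"
        using \<open>m > 0\<close> by (simp add: algebra_simps of_nat_diff)
      finally show ?thesis by (simp add: h_def)
    qed
    \<comment> \<open>The mean of \<open>cosh (s + t)\<close> and \<open>cosh (s - t)\<close> is
      \<open>cosh s * cosh t\<close>.\<close>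
    have interior: "cosh t * h e - (h (e - 1) + h (Suc e)) / 2 = 0" if "0 < e" for e
    proof -
      have "(real m / 2 - real (e - 1)) * t = (real m / 2 - real e) * t + t"
           "(real m / 2 - real (Suc e)) * t = (real m / 2 - real e) * t - t"
        using that by (simp_all add: algebra_simps of_nat_diff)
      then show ?thesis
        unfolding h_def by (simp add: cosh_add cosh_diff add_divide_distrib[symmetric])
    qed
    \<comment> \<open>Both neighbours of 0 carry the value \<open>h 1\<close>. What remains is
      \<open>sinh (m t / 2) * sinh t\<close> over the denominator of \<open>h\<close>, which was
      chosen to make this 1.\<close>
    have boundary: "cosh t * h 0 - (h (m - 1) + h 1) / 2 = 1"
    proof -
      have "(real m / 2 - real 1) * t = real m / 2 * t - t"
        by (simp add: algebra_simps)
      then have "h 1 = (cosh (real m / 2 * t) * cosh t - sinh (real m / 2 * t) * sinh t) /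
          (sinh t * sinh (real m / 2 * t))"
        unfolding h_def by (simp only: cosh_diff)
      then show ?thesis
        using nz unfolding h_pred by (simp add: h_def field_simps)
    qed
    have "(complex_of_real (cosh t) - complex_of_real (cos (2 * pi * real a / real m))) *
      (\<Sum>e<m. complex_of_real (h e) * cycle_char m a (- int e)) =
      1 - 0 * (\<Sum>e<m. cycle_char m a (- int e))"
    proof (rule cycle_resolvent_fourier[OF \<open>m > 0\<close>])
      show "complex_of_real (cosh t) * complex_of_real (h e) -
          (complex_of_real (h (e - 1)) + complex_of_real (h (Suc e))) / 2 = - 0" if "0 < e" for e
        using arg_cong[OF interior[OF that], of complex_of_real] by simp
      show "complex_of_real (cosh t) * complex_of_real (h 0) -
          (complex_of_real (h (m - 1)) + complex_of_real (h 1)) / 2 = 1 - 0"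
        using arg_cong[OF boundary, of complex_of_real] by simp
    qed (simp add: h_m)
    then show ?thesis by simp
  qed
  \<comment> \<open>For \<open>t > 0\<close> one has \<open>cosh t > 1\<close>, which exceeds every
    cosine.\<close>
  have pos: "complex_of_real (cosh t - cos (2 * pi * real a / real m)) \<noteq> 0" for a
    using cosh_real_ge_1[of t] \<open>t > 0\<close> cos_le_one[of "2 * pi * real a / real m"]
      cosh_real_one_iff[of t] by (simp only: of_real_eq_0_iff) linarith
  have "(\<Sum>a<m. cycle_char m a (int d) / complex_of_real (cosh t - cos (2 * pi * real a / real m))) =
     (\<Sum>a<m. (\<Sum>e<m. complex_of_real (h e) * cycle_char m a (- int e)) * cycle_char m a (int d))"
  proof (intro sum.cong refl)
    fix a
    have "(\<Sum>e<m. complex_of_real (h e) * cycle_char m a (- int e)) =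
        1 / complex_of_real (cosh t - cos (2 * pi * real a / real m))"
      using fourier[of a] pos[of a] by (simp add: field_simps del: of_real_diff)
    then show "cycle_char m a (int d) / complex_of_real (cosh t - cos (2 * pi * real a / real m)) =
       (\<Sum>e<m. complex_of_real (h e) * cycle_char m a (- int e)) * cycle_char m a (int d)"
      by simp
  qed
  also have "\<dots> = of_nat m * complex_of_real (h d)"
    by (rule cycle_fourier_inversion[OF \<open>d < m\<close>])
  finally show ?thesis by (simp add: h_def)
qed

lemma cos_eq_1_nat_iff:
  assumes "a < m"
  shows "cos (2 * pi * real a / real m) = 1 \<longleftrightarrow> a = 0"
proof
  assume "cos (2 * pi * real a / real m) = 1"
  then obtain e :: int where "2 * pi * real a / real m = of_int e * 2 * pi"
    unfolding cos_one_2pi_int by blast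
  then have "real a = of_int (e * int m)"
    using assms by (simp add: field_simps)
  then have "int a = e * int m"
    by (metis of_int_eq_iff of_int_of_nat_eq)
  then have "int m dvd int a - int 0" by simp
  then show "a = 0" using int_dvd_diff_iff_eq[of 0 m a] assms by simp
qed simp

text \<open>This explains the constant term of the quadratic: it makes the mean over the cycle zero,
  so that frequency 0 contributes nothing to the inversion.\<close>

lemma sum_centred_quadratic_eq_0:
  assumes "m > 0"
  shows "(\<Sum>e<m. (real m + 1) * (real m - 1) / (6 * real m) - real e + (real e)\<^sup>2 / real m) = 0"
proof -
  have s1: "(\<Sum>e<k. real e) = real k * (real k - 1) / 2" for k
    by (induction k) (simp_all add: field_simps)
  have s2: "(\<Sum>e<k. (real e)\<^sup>2) = real k * (real k - 1) * (2 * real k - 1) / 6" for k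
    by (induction k) (simp_all add: field_simps power2_eq_square)
  show ?thesis
    using assms unfolding sum.distrib sum_subtractf sum_divide_distrib[symmetric] s1 s2
    by (simp add: field_simps power2_eq_square)
qed

text \<open>The singular case \<open>z = 1\<close>: constants lie in the kernel of the operator, so
  the unit mass at 0 must first lose its mean, whence \<open>\<kappa> = 1 / m\<close>.\<close>

lemma sum_cycle_char_over_one_minus_cos_nat:
  assumes "d < m"
  shows "(\<Sum>a=1..<m. cycle_char m a (int d) / complex_of_real (1 - cos (2 * pi * real a / real m))) =
    complex_of_real (real m * ((real m + 1) * (real m - 1) / (6 * real m) - real d + (real d)\<^sup>2 / real m))"
proof -
  define h where "h e = (real m + 1) * (real m - 1) / (6 * real m) - real e + (real e)\<^sup>2 / real m" for e :: nat
  have "m > 0" using assms by simp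
  have h_m: "h m = h 0"
    by (simp add: h_def power2_eq_square)
  \<comment> \<open>Constant and linear terms have no second difference; the square contributes
    \<open>2 / m\<close>, which is then multiplied by -1/2.\<close>
  have interior: "1 * h e - (h (e - 1) + h (Suc e)) / 2 = - (1 / real m)" if "0 < e" for e
    using that \<open>m > 0\<close> by (simp add: h_def of_nat_diff field_simps power2_eq_square)
  have boundary: "1 * h 0 - (h (m - 1) + h 1) / 2 = 1 - 1 / real m"
    using \<open>m > 0\<close> by (simp add: h_def of_nat_diff field_simps power2_eq_square)
  have fourier: "(1 - complex_of_real (cos (2 * pi * real a / real m))) *
      (\<Sum>e<m. complex_of_real (h e) * cycle_char m a (- int e)) =
      1 - complex_of_real (1 / real m) * (\<Sum>e<m. cycle_char m a (- int e))" for a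
  proof (rule cycle_resolvent_fourier[OF \<open>m > 0\<close>])
    show "1 * complex_of_real (h e) -
        (complex_of_real (h (e - 1)) + complex_of_real (h (Suc e))) / 2 = - complex_of_real (1 / real m)"
      if "0 < e" for e
      using arg_cong[OF interior[OF that], of complex_of_real] by simp
    show "1 * complex_of_real (h 0) -
        (complex_of_real (h (m - 1)) + complex_of_real (h 1)) / 2 = 1 - complex_of_real (1 / real m)"
      using arg_cong[OF boundary, of complex_of_real] by simp
  qed (simp add: h_m)
  have "of_nat m * complex_of_real (h d) =
     (\<Sum>a<m. (\<Sum>e<m. complex_of_real (h e) * cycle_char m a (- int e)) * cycle_char m a (int d))"
    by (rule cycle_fourier_inversion[OF \<open>d < m\<close>, symmetric])
  also have "\<dots> = (\<Sum>e<m. complex_of_real (h e)) +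
     (\<Sum>a=1..<m. (\<Sum>e<m. complex_of_real (h e) * cycle_char m a (- int e)) * cycle_char m a (int d))"
    using \<open>m > 0\<close> by (simp add: lessThan_atLeast0 sum.atLeast_Suc_lessThan)
  also have "(\<Sum>e<m. complex_of_real (h e)) = 0"
    using sum_centred_quadratic_eq_0[OF \<open>m > 0\<close>]
    by (simp only: of_real_sum[symmetric] h_def) simp
  also have "(\<Sum>a=1..<m. (\<Sum>e<m. complex_of_real (h e) * cycle_char m a (- int e)) * cycle_char m a (int d)) =
     (\<Sum>a=1..<m. cycle_char m a (int d) / complex_of_real (1 - cos (2 * pi * real a / real m)))"
  proof (intro sum.cong refl)
    fix a assume a: "a \<in> {1..<m}"
    \<comment> \<open>At a nonzero frequency the correction by \<open>\<kappa>\<close> disappears,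
      being orthogonal to the character.\<close>
    have "(\<Sum>e<m. cycle_char m a (- int e)) = 0"
      using sum_cycle_char_orthogonal[of a m 0] a by simp
    moreover have "complex_of_real (1 - cos (2 * pi * real a / real m)) \<noteq> 0"
      using cos_eq_1_nat_iff[of a m] a by (simp only: of_real_eq_0_iff) auto
    ultimately have "(\<Sum>e<m. complex_of_real (h e) * cycle_char m a (- int e)) =
        1 / complex_of_real (1 - cos (2 * pi * real a / real m))"
      using fourier[of a] by (simp add: field_simps)
    then show "(\<Sum>e<m. complex_of_real (h e) * cycle_char m a (- int e)) * cycle_char m a (int d) =
       cycle_char m a (int d) / complex_of_real (1 - cos (2 * pi * real a / real m))"
      by simp
  qed
  finally show ?thesis by (simp add: h_def)
qed

text \<open>Reversing the sign of \<open>d\<close> conjugates each character, while the weights and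
  the total are real.\<close>

lemma cycle_char_sum_abs:
  assumes "(\<Sum>a\<in>A. cycle_char m a \<bar>d\<bar> / complex_of_real (g a)) = complex_of_real s"
  shows "(\<Sum>a\<in>A. cycle_char m a d / complex_of_real (g a)) = complex_of_real s"
proof (cases "d \<ge> 0")
  case False
  have "(\<Sum>a\<in>A. cycle_char m a d / complex_of_real (g a)) =
      cnj (\<Sum>a\<in>A. cycle_char m a \<bar>d\<bar> / complex_of_real (g a))"
    using False by (simp add: cnj_cycle_char)
  then show ?thesis by (simp add: assms)
qed (use assms in simp)

lemma sum_cycle_char_over_cosh_minus_cos:
  fixes t :: real
  assumes "t > 0" "\<bar>d\<bar> < int m"
  shows "(\<Sum>a<m. cycle_char m a d / complex_of_real (cosh t - cos (2 * pi * real a / real m))) =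
    complex_of_real (real m * cosh ((real m / 2 - \<bar>real_of_int d\<bar>) * t) / (sinh t * sinh (real m / 2 * t)))"
proof (rule cycle_char_sum_abs)
  have "real (nat \<bar>d\<bar>) = \<bar>real_of_int d\<bar>" "int (nat \<bar>d\<bar>) = \<bar>d\<bar>" by simp_all
  then show "(\<Sum>a<m. cycle_char m a \<bar>d\<bar> / complex_of_real (cosh t - cos (2 * pi * real a / real m))) =
    complex_of_real (real m * cosh ((real m / 2 - \<bar>real_of_int d\<bar>) * t) / (sinh t * sinh (real m / 2 * t)))"
    using sum_cycle_char_over_cosh_minus_cos_nat[of t "nat \<bar>d\<bar>" m] assms by simp
qed

lemma sum_cycle_char_over_one_minus_cos:
  assumes "\<bar>d\<bar> < int m"
  shows "(\<Sum>a=1..<m. cycle_char m a d / complex_of_real (1 - cos (2 * pi * real a / real m))) =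
    complex_of_real (real m * ((real m + 1) * (real m - 1) / (6 * real m)
      - \<bar>real_of_int d\<bar> + (real_of_int d)\<^sup>2 / real m))"
proof (rule cycle_char_sum_abs)
  have "real (nat \<bar>d\<bar>) = \<bar>real_of_int d\<bar>" "int (nat \<bar>d\<bar>) = \<bar>d\<bar>" by simp_all
  then show "(\<Sum>a=1..<m. cycle_char m a \<bar>d\<bar> / complex_of_real (1 - cos (2 * pi * real a / real m))) =
    complex_of_real (real m * ((real m + 1) * (real m - 1) / (6 * real m)
      - \<bar>real_of_int d\<bar> + (real_of_int d)\<^sup>2 / real m))"
    using sum_cycle_char_over_one_minus_cos_nat[of "nat \<bar>d\<bar>" m] assms by simp
qed

section \<open>Adjacency, the torus Laplacian and its eigensystem of characters\<close>

text \<open>Passes from integer congruences to natural residues. The predecessor is written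
  \<open>x + m - 1\<close> because \<open>x - 1\<close> would truncate at
  \<open>x = 0\<close>.\<close>

lemma cycle_adj_iff:
  assumes "x < m" "y < m"
  shows "cycle_adj m x y \<longleftrightarrow> y = (x + 1) mod m \<or> y = (x + m - 1) mod m"
proof -
  have "[int y = int x + 1] (mod int m) \<longleftrightarrow> [y = x + 1] (mod m)"
    using cong_int_iff[of y "x + 1" m] by (simp add: add.commute)
  moreover have "[int y = int x - 1] (mod int m) \<longleftrightarrow> [y = x + m - 1] (mod m)"
  proof -
    have "[int y = int x - 1] (mod int m) \<longleftrightarrow> [int y = int x - 1 + int m] (mod int m)"
      by (simp add: cong_def)
    also have "int x - 1 + int m = int (x + m - 1)"
      using assms by (simp add: of_nat_diff)
    finally show ?thesis by (simp only: cong_int_iff)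
  qed
  ultimately show ?thesis
    using assms by (simp add: cycle_adj_def) (simp add: cong_def)
qed

lemma cycle_adj_commute: "cycle_adj m x y \<longleftrightarrow> cycle_adj m y x"
proof -
  have "[int y = int x + 1] (mod int m) \<longleftrightarrow> [int x = int y - 1] (mod int m)" for x y
    by (auto simp: cong_iff_dvd_diff dvd_diff_commute algebra_simps)
  then show ?thesis
    by (auto simp: cycle_adj_def)
qed

text \<open>Here the bound on \<open>m\<close> enters: for \<open>m = 2\<close> the two neighbours
  coincide, and for \<open>m = 1\<close> they are the vertex itself.\<close>

lemma cycle_neighbours_distinct:
  fixes m x :: nat
  assumes "m \<ge> 3" "x < m"
  shows "(x + 1) mod m \<noteq> (x + m - 1) mod m" "(x + 1) mod m \<noteq> x" "(x + m - 1) mod m \<noteq> x"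
proof -
  have "(x + 1) mod m = (if x + 1 = m then 0 else x + 1)"
    using assms by auto
  moreover have "(x + m - 1) mod m = (if x = 0 then m - 1 else x - 1)"
    using assms by (cases x) auto
  ultimately show "(x + 1) mod m \<noteq> (x + m - 1) mod m" "(x + 1) mod m \<noteq> x" "(x + m - 1) mod m \<noteq> x"
    using assms by (auto split: if_splits)
qed

lemma not_cycle_adj_self:
  assumes "m \<ge> 3"
  shows "\<not> cycle_adj m x x"
  using cycle_adj_iff[of x m x] cycle_neighbours_distinct[OF assms, of x]
  by (auto simp: cycle_adj_def)

text \<open>A step to either neighbour multiplies the character by one of two conjugate roots of
  unity, whose sum is twice a cosine.\<close>

lemma sum_cycle_adj_char:
  assumes "m \<ge> 3" "x < m"
  shows "(\<Sum>y<m. if cycle_adj m x y then cycle_char m a (- int y) else 0) =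
    2 * complex_of_real (cos (2 * pi * real a / real m)) * cycle_char m a (- int x)"
proof -
  let ?p = "(x + 1) mod m" and ?q = "(x + m - 1) mod m"
  have "(\<Sum>y<m. if cycle_adj m x y then cycle_char m a (- int y) else 0) =
      (\<Sum>y\<in>{?p, ?q}. cycle_char m a (- int y))"
    using assms by (intro sum.mono_neutral_cong_right) (auto simp: cycle_adj_iff)
  also have "\<dots> = cycle_char m a (- int ?p) + cycle_char m a (- int ?q)"
    using cycle_neighbours_distinct[OF assms] by simp
  also have "cycle_char m a (- int ?p) = cycle_char m a (- int x + - 1)"
    by (rule cycle_char_cong) (simp add: cong_def zmod_int mod_minus_eq algebra_simps)
  also have "cycle_char m a (- int ?q) = cycle_char m a (- int x + 1)"
  proof (rule cycle_char_cong)
    have "[- int ?q = - int (x + m - 1)] (mod int m)"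
      by (simp add: cong_def zmod_int mod_minus_eq)
    also have "- int (x + m - 1) = - int x + 1 - int m"
      using assms by (simp add: of_nat_diff)
    also have "[\<dots> = - int x + 1] (mod int m)"
      by (simp add: cong_def)
    finally show "[- int ?q = - int x + 1] (mod int m)" .
  qed
  also have "cycle_char m a (- int x + - 1) + cycle_char m a (- int x + 1) =
      (cycle_char m a 1 + cycle_char m a (- 1)) * cycle_char m a (- int x)"
    unfolding cycle_char_add by (simp add: algebra_simps)
  finally show ?thesis
    unfolding cycle_char_plus_inverse .
qed

lemma torus_laplacian_commute: "torus_laplacian m n v w = torus_laplacian m n w v"
  by (auto simp: torus_laplacian_def torus_adj_def cycle_adj_commute)

lemma torus_laplacian_apply:
  fixes f :: "nat \<times> nat \<Rightarrow> complex"
  assumes "m \<ge> 3" "n \<ge> 3" "x < m" "x' < n"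
  shows "(\<Sum>w\<in>torus_verts m n. complex_of_real (torus_laplacian m n (x, x') w) * f w) =
    f (x, x') - ((\<Sum>y'<n. if cycle_adj n x' y' then f (x, y') else 0) +
                 (\<Sum>y<m. if cycle_adj m x y then f (y, x') else 0)) / 4"
proof -
  have "(\<Sum>w\<in>torus_verts m n. complex_of_real (torus_laplacian m n (x, x') w) * f w) =
    (\<Sum>y<m. \<Sum>y'<n. complex_of_real (torus_laplacian m n (x, x') (y, y')) * f (y, y'))"
    by (simp add: torus_verts_def sum.cartesian_product)
  \<comment> \<open>The three terms are the diagonal, the edges along C_n and the edges along C_m.
    As there are no loops, at most one of them is present for each vertex.\<close>
  also have "\<dots> = (\<Sum>y<m. \<Sum>y'<n.
      (if y = x then if y' = x' then f (y, y') else 0 else 0)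
      - (if y = x then if cycle_adj n x' y' then f (y, y') / 4 else 0 else 0)
      - (if y' = x' then if cycle_adj m x y then f (y, y') / 4 else 0 else 0))"
    using assms
    by (intro sum.cong refl)
      (auto simp: torus_laplacian_def torus_adj_def torus_verts_def not_cycle_adj_self)
  also have "\<dots> = f (x, x') - (\<Sum>y'<n. if cycle_adj n x' y' then f (x, y') / 4 else 0)
      - (\<Sum>y<m. if cycle_adj m x y then f (y, x') / 4 else 0)"
  proof -
    have pull: "(\<Sum>y'<n. if y = x then F y' else 0) = (if y = x then \<Sum>y'<n. F y' else 0)"
      for y and F :: "nat \<Rightarrow> complex" by simp
    show ?thesis
      unfolding sum_subtractf pull using assms by simp
  qed
  also have "(\<Sum>y'<n. if cycle_adj n x' y' then f (x, y') / 4 else 0) =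
      (\<Sum>y'<n. if cycle_adj n x' y' then f (x, y') else 0) / 4"
    unfolding sum_divide_distrib by (intro sum.cong) auto
  also have "(\<Sum>y<m. if cycle_adj m x y then f (y, x') / 4 else 0) =
      (\<Sum>y<m. if cycle_adj m x y then f (y, x') else 0) / 4"
    unfolding sum_divide_distrib by (intro sum.cong) auto
  finally show ?thesis by (simp add: algebra_simps add_divide_distrib)
qed

definition torus_eigenvalue :: "nat \<Rightarrow> nat \<Rightarrow> nat \<Rightarrow> nat \<Rightarrow> real" where
  "torus_eigenvalue m n a b =
     1 - (cos (2 * pi * real a / real m) + cos (2 * pi * real b / real n)) / 2"

text \<open>The negative positions make the product of a value at \<open>v\<close> with a conjugate
  value at \<open>w\<close> a character of \<open>w - v\<close>, the orientation of the final
  formula.\<close>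

definition torus_eigenfunction :: "nat \<Rightarrow> nat \<Rightarrow> nat \<Rightarrow> nat \<Rightarrow> nat \<times> nat \<Rightarrow> complex" where
  "torus_eigenfunction m n a b v =
     cycle_char m a (- int (fst v)) * cycle_char n b (- int (snd v)) / complex_of_real (sqrt (real (m * n)))"

text \<open>The index \<open>j\<close> encodes the pair of frequencies
  \<open>(j div n, j mod n)\<close>. Each direction contributes twice a cosine to the neighbour sum,
  and the weight 1/4 turns these into the mean of the two cosines. Orthogonality factors over the
  two cycles.\<close>

lemma torus_orthonormal_eigensystem:
  assumes "m \<ge> 3" "n \<ge> 3"
  shows "orthonormal_eigensystem (torus_verts m n) (torus_laplacian m n)
    (\<lambda>j. torus_eigenvalue m n (j div n) (j mod n))
    (\<lambda>j. torus_eigenfunction m n (j div n) (j mod n))"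
proof -
  have card: "card (torus_verts m n) = m * n"
    by (simp add: torus_verts_def)
  have eigen: "(\<Sum>w\<in>torus_verts m n. complex_of_real (torus_laplacian m n v w) * torus_eigenfunction m n a b w) =
      complex_of_real (torus_eigenvalue m n a b) * torus_eigenfunction m n a b v"
    if v: "v \<in> torus_verts m n" for a b v
  proof -
    obtain x x' where vx: "v = (x, x')" "x < m" "x' < n"
      using v by (auto simp: torus_verts_def)
    define s where "s = complex_of_real (sqrt (real (m * n)))"
    have 1: "(\<Sum>y'<n. if cycle_adj n x' y' then torus_eigenfunction m n a b (x, y') else 0) =
        cycle_char m a (- int x) / s * (\<Sum>y'<n. if cycle_adj n x' y' then cycle_char n b (- int y') else 0)"
      unfolding sum_distrib_left by (intro sum.cong refl) (simp add: torus_eigenfunction_def s_def)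
    have 2: "(\<Sum>y<m. if cycle_adj m x y then torus_eigenfunction m n a b (y, x') else 0) =
        cycle_char n b (- int x') / s * (\<Sum>y<m. if cycle_adj m x y then cycle_char m a (- int y) else 0)"
      unfolding sum_distrib_left by (intro sum.cong refl) (simp add: torus_eigenfunction_def s_def)
    have e: "torus_eigenfunction m n a b (x, x') = cycle_char m a (- int x) * cycle_char n b (- int x') / s"
      by (simp add: torus_eigenfunction_def s_def)
    show ?thesis
      unfolding vx(1) torus_laplacian_apply[OF assms vx(2,3)] 1 2
        sum_cycle_adj_char[OF assms(1) vx(2)] sum_cycle_adj_char[OF assms(2) vx(3)] e torus_eigenvalue_def
      by (simp add: algebra_simps add_divide_distrib diff_divide_distrib)
  qed
  have orth: "(\<Sum>v\<in>torus_verts m n. torus_eigenfunction m n a b v * cnj (torus_eigenfunction m n a' b' v)) =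
      (if a = a' \<and> b = b' then 1 else 0)" if "a < m" "a' < m" "b < n" "b' < n" for a a' b b'
  proof -
    define s where "s = complex_of_real (sqrt (real (m * n)))"
    have s: "s * s = of_nat m * of_nat n" "cnj s = s"
      unfolding s_def of_real_mult[symmetric] by simp_all
    have "(\<Sum>v\<in>torus_verts m n. torus_eigenfunction m n a b v * cnj (torus_eigenfunction m n a' b' v)) =
      (\<Sum>x<m. \<Sum>x'<n. (cycle_char m a (- int x) * cnj (cycle_char m a' (- int x))) *
        (cycle_char n b (- int x') * cnj (cycle_char n b' (- int x'))) / (s * s))"
      unfolding torus_verts_def torus_eigenfunction_def s_def[symmetric]
      by (simp add: sum.cartesian_product s case_prod_unfold mult_ac)
    also have "\<dots> = (\<Sum>x<m. cycle_char m a (- int x) * cnj (cycle_char m a' (- int x))) *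
        (\<Sum>x'<n. cycle_char n b (- int x') * cnj (cycle_char n b' (- int x'))) / (s * s)"
      by (simp only: sum_product sum_divide_distrib)
    also have "\<dots> = (if a = a' \<and> b = b' then 1 else 0)"
      using that by (simp add: sum_cycle_char_orthogonal s(1))
    finally show ?thesis .
  qed
  have "j div n < m" if "j < m * n" for j
    using that by (simp add: less_mult_imp_div_less)
  moreover have "j div n = k div n \<and> j mod n = k mod n \<longleftrightarrow> j = k" for j k
    by (metis div_mult_mod_eq)
  ultimately show ?thesis
    unfolding orthonormal_eigensystem_def card using assms by (auto simp: eigen orth)
qed

section \<open>The Green's function as a double character sum\<close>

lemma sum_nat_mult:
  fixes F :: "nat \<Rightarrow> nat \<Rightarrow> 'a :: comm_monoid_add"
  shows "(\<Sum>j<m * n. F (j div n) (j mod n)) = (\<Sum>a<m. \<Sum>b<n. F a b)"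
proof -
  have "bij_betw (\<lambda>j. (j div n, j mod n)) {..<m * n} ({..<m} \<times> {..<n})"
  proof (rule bij_betw_byWitness[where f' = "\<lambda>(a, b). a * n + b"])
    show "(\<lambda>(a, b). a * n + b) ` ({..<m} \<times> {..<n}) \<subseteq> {..<m * n}"
    proof safe
      fix a b assume "a < m" "b < n"
      then have "a * n + b < Suc a * n" "Suc a * n \<le> m * n"
        by (auto intro: mult_le_mono1 simp del: mult_Suc) simp
      then show "a * n + b < m * n" by linarith
    qed
  qed (auto simp: less_mult_imp_div_less intro!: mod_less_divisor gr0I)
  then have "(\<Sum>j<m * n. (\<lambda>(a, b). F a b) (j div n, j mod n)) = (\<Sum>(a, b)\<in>{..<m} \<times> {..<n}. F a b)"
    by (rule sum.reindex_bij_betw)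
  then show ?thesis by (simp add: sum.cartesian_product)
qed

lemma torus_green_eq_character_sum:
  assumes "m \<ge> 3" "n \<ge> 3" "x < m" "y < m" "x' < n" "y' < n"
  shows "torus_green m n (x, x') (y, y') =
    (\<Sum>a<m. \<Sum>b<n. (if torus_eigenvalue m n a b > 0 then complex_of_real (1 / torus_eigenvalue m n a b) else 0) *
      cycle_char m a (int y - int x) * cycle_char n b (int y' - int x')) / (of_nat m * of_nat n)"
proof -
  let ?g = "\<lambda>a b. if torus_eigenvalue m n a b > 0 then complex_of_real (1 / torus_eigenvalue m n a b) else 0"
  let ?phi = "torus_eigenfunction m n"
  \<comment> \<open>Translation invariance: each spectral term depends only on the difference of the
    two vertices.\<close>
  have phi: "?phi a b (x, x') * cnj (?phi a b (y, y')) =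
      cycle_char m a (int y - int x) * cycle_char n b (int y' - int x') / (of_nat m * of_nat n)" for a b
  proof -
    define s where "s = complex_of_real (sqrt (real (m * n)))"
    have s: "s * s = of_nat m * of_nat n" "cnj s = s"
      unfolding s_def of_real_mult[symmetric] by simp_all
    show ?thesis
      unfolding torus_eigenfunction_def s_def[symmetric] s(1)[symmetric]
      using cycle_char_add[of m a "int y" "- int x"] cycle_char_add[of n b "int y'" "- int x'"]
      by (simp add: cnj_cycle_char s(2) mult_ac)
  qed
  have "torus_green m n (x, x') (y, y') =
    (\<Sum>j<m * n. ?g (j div n) (j mod n) * ?phi (j div n) (j mod n) (x, x') * cnj (?phi (j div n) (j mod n) (y, y')))"
    unfolding torus_green_def
    using assms greens_function_eq_spectral_sum[OF _ torus_laplacian_commute torus_orthonormal_eigensystem,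
        of m n "(x, x')" "(y, y')"]
    by (simp add: torus_verts_def)
  also have "\<dots> = (\<Sum>a<m. \<Sum>b<n. ?g a b * ?phi a b (x, x') * cnj (?phi a b (y, y')))"
    by (rule sum_nat_mult)
  finally show ?thesis
    unfolding sum_divide_distrib by (simp only: mult.assoc phi times_divide_eq_right)
qed

section \<open>Chebyshev form and assembly of the formula\<close>

text \<open>With \<open>z = cosh t\<close> the product \<open>(z - 1) * (z + 1)\<close> is the
  square of \<open>sinh t\<close>; one factor cancels the denominator of \<open>cheb_U\<close>,
  whose index \<open>m / 2 - 1\<close> is shifted to \<open>m / 2\<close> by its definition.\<close>

lemma cheb_T_over_cheb_U:
  assumes "z > 1" "m > 0"
  shows "cheb_T \<nu> z / ((z - 1) * (z + 1) * cheb_U (real m / 2 - 1) z) =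
    cosh (\<nu> * arcosh z) / (sinh (arcosh z) * sinh (real m / 2 * arcosh z))"
proof -
  let ?t = "arcosh z"
  have "?t > 0" using assms by simp
  then have nz: "sinh ?t \<noteq> 0" "sinh (real m / 2 * ?t) \<noteq> 0"
    using assms(2) by simp_all
  have "(z - 1) * (z + 1) = sinh ?t * sinh ?t"
    using cosh_square_eq[of ?t] assms by (simp add: power2_eq_square algebra_simps)
  then show ?thesis
    unfolding cheb_T_def cheb_U_def using nz by (simp add: field_simps)
qed

theorem theorem12:
  fixes m n x y x' y' :: nat
  assumes "m \<ge> 3" and "n \<ge> 3"
    and "x < m" and "y < m" and "x' < n" and "y' < n"
  shows "torus_green m n (x, x') (y, y') =
    (let c = (\<lambda>k::nat. cos (2 * pi * real k / real n)) in
      complex_of_real (2 / real n) *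
        (\<Sum>k = 1..n - 1.
           exp ((2 * complex_of_real pi * \<i> * of_nat k / of_nat n) * (of_nat y' - of_nat x')) *
           complex_of_real
             (- 1 / (real m * (1 - c k)) +
              cheb_T (real m / 2 - \<bar>real y - real x\<bar>) (2 - c k) /
                ((1 - c k) * (3 - c k) * cheb_U (real m / 2 - 1) (2 - c k)))) +
      complex_of_real
        (2 / real n * ((real m + 1) * (real m - 1) / (6 * real m)
            - \<bar>real y - real x\<bar> + (real y - real x)\<^sup>2 / real m)) +
      complex_of_real
        (2 / real m * ((real n + 1) * (real n - 1) / (6 * real n)
            - \<bar>real y' - real x'\<bar> + (real y' - real x')\<^sup>2 / real n)))"
proof -
  define c where "c k = cos (2 * pi * real k / real n)" for k :: nat
  define d d' where "d = int y - int x" and "d' = int y' - int x'"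
  define T where "T k = cheb_T (real m / 2 - \<bar>real y - real x\<bar>) (2 - c k) /
                ((1 - c k) * (3 - c k) * cheb_U (real m / 2 - 1) (2 - c k))" for k
  define g where "g a b = (if torus_eigenvalue m n a b > 0
      then complex_of_real (1 / torus_eigenvalue m n a b) else 0)" for a b
  define Q where "Q N e = (real N + 1) * (real N - 1) / (6 * real N) - \<bar>real_of_int e\<bar> + (real_of_int e)\<^sup>2 / real N"
    for N :: nat and e :: int
  have mn: "m > 0" "n > 0" using assms by auto
  have d: "\<bar>d\<bar> < int m" "real_of_int d = real y - real x" and d': "\<bar>d'\<bar> < int n" "real_of_int d' = real y' - real x'"
    using assms by (auto simp: d_def d'_def)
  have c_less: "c b < 1" if "b \<in> {1..<n}" for b
    using cos_eq_1_nat_iff[of b n] cos_le_one[of "2 * pi * real b / real n"] that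
    by (auto simp: c_def less_le)
  have row: "(\<Sum>a<m. g a b * cycle_char m a d) = complex_of_real (2 * real m * T b)" if b: "b \<in> {1..<n}" for b
  proof -
    have z: "2 - c b > 1" using c_less[OF b] by simp
    \<comment> \<open>The eigenvalue is half of \<open>cosh t - cos\<close> with
      \<open>t = arcosh (2 - c b)\<close>, and it is positive because \<open>b\<close> is
      nonzero.\<close>
    have "g a b = 2 / complex_of_real (cosh (arcosh (2 - c b)) - cos (2 * pi * real a / real m))" for a
    proof -
      have ev: "torus_eigenvalue m n a b = (2 - c b - cos (2 * pi * real a / real m)) / 2"
        by (simp add: torus_eigenvalue_def c_def field_simps)
      moreover have "2 - c b - cos (2 * pi * real a / real m) > 0"
        using z cos_le_one[of "2 * pi * real a / real m"] by linarith
      ultimately show ?thesis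
        using z unfolding g_def ev by simp
    qed
    then have "(\<Sum>a<m. g a b * cycle_char m a d) =
        2 * (\<Sum>a<m. cycle_char m a d / complex_of_real (cosh (arcosh (2 - c b)) - cos (2 * pi * real a / real m)))"
      unfolding sum_distrib_left by (intro sum.cong refl) simp
    also have "\<dots> = 2 * complex_of_real (real m * (cosh ((real m / 2 - \<bar>real y - real x\<bar>) * arcosh (2 - c b)) /
        (sinh (arcosh (2 - c b)) * sinh (real m / 2 * arcosh (2 - c b)))))"
      using z d by (subst sum_cycle_char_over_cosh_minus_cos) simp_all
    also have "\<dots> = complex_of_real (2 * real m * T b)"
      unfolding cheb_T_over_cheb_U[OF z mn(1), symmetric] T_def by (simp add: algebra_simps)
    finally show ?thesis .
  qed
  \<comment> \<open>In the row \<open>b = 0\<close> the pair of zero frequencies has eigenvalue 0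
    and weight 0; the rest is the singular sum on C_m.\<close>
  have zero_row: "(\<Sum>a<m. g a 0 * cycle_char m a d) = complex_of_real (2 * real m * Q m d)"
  proof -
    have g0: "g 0 0 = 0" by (simp add: g_def torus_eigenvalue_def)
    have "(\<Sum>a<m. g a 0 * cycle_char m a d) = (\<Sum>a=1..<m. g a 0 * cycle_char m a d)"
      using mn g0 by (simp add: lessThan_atLeast0 sum.atLeast_Suc_lessThan)
    also have "\<dots> = 2 * (\<Sum>a=1..<m. cycle_char m a d / complex_of_real (1 - cos (2 * pi * real a / real m)))"
      unfolding sum_distrib_left
    proof (intro sum.cong refl)
      fix a assume "a \<in> {1..<m}"
      then have "cos (2 * pi * real a / real m) < 1"
        using cos_eq_1_nat_iff[of a m] cos_le_one[of "2 * pi * real a / real m"] by (auto simp: less_le)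
      moreover have ev: "torus_eigenvalue m n a 0 = (1 - cos (2 * pi * real a / real m)) / 2"
        by (simp add: torus_eigenvalue_def field_simps)
      ultimately show "g a 0 * cycle_char m a d =
          2 * (cycle_char m a d / complex_of_real (1 - cos (2 * pi * real a / real m)))"
        unfolding g_def ev by simp
    qed
    also have "\<dots> = complex_of_real (2 * real m * Q m d)"
      unfolding sum_cycle_char_over_one_minus_cos[OF d(1)] Q_def by simp
    finally show ?thesis .
  qed
  \<comment> \<open>The last summand of the formula is itself a character sum over the nonzero
    frequencies of C_n, by the singular case applied to that cycle.\<close>
  have col: "complex_of_real (2 / real m * Q n d') =
      complex_of_real (2 / real n) * (\<Sum>b=1..<n. cycle_char n b d' * complex_of_real (1 / (real m * (1 - c b))))"
  proof -
    have "(\<Sum>b=1..<n. cycle_char n b d' * complex_of_real (1 / (real m * (1 - c b)))) =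
        (\<Sum>b=1..<n. cycle_char n b d' / complex_of_real (1 - c b)) / of_nat m"
      unfolding sum_divide_distrib by (intro sum.cong refl) simp
    also have "\<dots> = complex_of_real (real n * Q n d') / of_nat m"
      unfolding c_def sum_cycle_char_over_one_minus_cos[OF d'(1)] Q_def ..
    finally show ?thesis using mn by simp
  qed
  have char_exp: "exp ((2 * complex_of_real pi * \<i> * of_nat k / of_nat n) * (of_nat y' - of_nat x')) =
      cycle_char n k d'" for k
    by (simp add: cycle_char_def cis_conv_exp d'_def mult_ac)
  have "torus_green m n (x, x') (y, y') =
      (\<Sum>a<m. \<Sum>b<n. g a b * cycle_char m a d * cycle_char n b d') / (of_nat m * of_nat n)"
    using torus_green_eq_character_sum[OF assms] by (simp add: g_def d_def d'_def)
  also have "(\<Sum>a<m. \<Sum>b<n. g a b * cycle_char m a d * cycle_char n b d') =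
      (\<Sum>b<n. (\<Sum>a<m. g a b * cycle_char m a d) * cycle_char n b d')"
    by (subst sum.swap) (simp add: sum_distrib_right)
  also have "\<dots> = complex_of_real (2 * real m * Q m d) +
      (\<Sum>b=1..<n. (\<Sum>a<m. g a b * cycle_char m a d) * cycle_char n b d')"
    using mn by (simp add: lessThan_atLeast0[of n] sum.atLeast_Suc_lessThan zero_row)
  also have "(\<Sum>b=1..<n. (\<Sum>a<m. g a b * cycle_char m a d) * cycle_char n b d') =
      complex_of_real (2 * real m) * (\<Sum>b=1..<n. cycle_char n b d' * complex_of_real (T b))"
    unfolding sum_distrib_left by (intro sum.cong refl) (simp add: row)
  also have "(complex_of_real (2 * real m * Q m d) +
      complex_of_real (2 * real m) * (\<Sum>b=1..<n. cycle_char n b d' * complex_of_real (T b))) / (of_nat m * of_nat n) =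
      complex_of_real (2 / real n) * (\<Sum>b=1..<n. cycle_char n b d' * complex_of_real (T b)) +
      complex_of_real (2 / real n * Q m d)"
    using mn by (simp add: field_simps)
  \<comment> \<open>The terms \<open>- 1 / (real m * (1 - c b))\<close> are inserted and, by
    \<open>col\<close>, compensated exactly by the added \<open>Q n d'\<close>.\<close>
  also have "\<dots> = complex_of_real (2 / real n) *
        (\<Sum>b=1..<n. cycle_char n b d' * complex_of_real (- 1 / (real m * (1 - c b)) + T b)) +
      complex_of_real (2 / real n * Q m d) + complex_of_real (2 / real m * Q n d')"
    unfolding col by (simp add: sum.distrib sum_subtractf sum_negf algebra_simps)
  finally have "torus_green m n (x, x') (y, y') = complex_of_real (2 / real n) *
        (\<Sum>b=1..<n. cycle_char n b d' * complex_of_real (- 1 / (real m * (1 - c b)) + T b)) +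
      complex_of_real (2 / real n * Q m d) + complex_of_real (2 / real m * Q n d')" .
  moreover have "{1..n - 1} = {1..<n}" using mn by auto
  ultimately show ?thesis
    unfolding Let_def char_exp c_def[symmetric] T_def[symmetric] by (simp only: Q_def d(2) d'(2))
qed

end
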